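(* Let $c$ and $n$ be odd positive integers with $n>c>\frac{n}{2}$. Let $K$ be the set partition of $S_c$ whose only part with more than one element is the set of cyclic shifts of the identity, $\{12\cdots c,\ 23\cdots c1,\ \ldots,\ c12\cdots(c-1)\}$. Then, under the $K$-equivalence on $S_n$, the number of odd non-avoiders exceeds the number of even non-avoiders by $n\,C_{\frac{n-c-2}{2}}$; that is, the odd nontrivial class has $n\,C_{\frac{n-c-2}{2}}$ more permutations than the even nontrivial class. Here $C_r=\frac{1}{r+1}\binom{2r}{r}$ is the $r$th Catalan number.
   Context: Permutations are written in one-line notation as words. The order permutation (standardization) of a word $u$ of distinct positive integers of length $\ell$ is the unique $\pi\in S_\ell$ with $\pi_i<\pi_j$ iff $u_i<u_j$. The $K$-equivalence on $S_n$ is the equivalence relation generated by declaring $\phi\equiv\psi$ whenever $\phi=aub$ and $\psi=avb$ for words $a,b,u,v$ with $u,v$ of length $c$ whose order permutations lie in the same part of $K$. A hit is a contiguous subword of length $c$ whose order permutation is a cyclic shift of the identity of $S_c$; a non-avoider is a permutation containing a hit. A class is nontrivial if it has more than one element. Since $c$ is odd, every transformation preserves the parity (sign) of the permutation, and for $n>c$ the nontrivial classes are exactly the set of even non-avoiders (the "even nontrivial class") and the set of odd non-avoiders (the "odd nontrivial class"). *)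

theory Defs
  imports Main
begin

definition perms :: "nat \<Rightarrow> nat list set" where
  "perms n = {p. distinct p \<and> set p = {1..n}}"

definition std :: "nat list \<Rightarrow> nat list" where
  "std u = map (\<lambda>x. card {y \<in> set u. y \<le> x}) u"

definition cyc_shifts :: "nat \<Rightarrow> nat list set" where
  "cyc_shifts c = {rotate k [1..<c+1] | k. k < c}"

definition has_hit :: "nat \<Rightarrow> nat list \<Rightarrow> bool" where
  "has_hit c p \<longleftrightarrow> (\<exists>i. i + c \<le> length p \<and> std (take c (drop i p)) \<in> cyc_shifts c)"

definition inversions :: "nat list \<Rightarrow> nat" where
  "inversions p = card {(i, j). i < j \<and> j < length p \<and> p ! i > p ! j}"

definition odd_perm :: "nat list \<Rightarrow> bool" where
  "odd_perm p \<longleftrightarrow> odd (inversions p)"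

definition catalan :: "nat \<Rightarrow> nat" where
  "catalan r = ((2 * r) choose r) div (r + 1)"

end

theory Submission
  imports Defs "HOL-Library.Multiset"
begin

text \<open>Let $d = n - c$ and count permutations with their sign. A nonempty finite set of hit positions
  has one element more than it has pairs of consecutive elements, so the signed sum over the
  non-avoiders is the sum over single hits minus the sum over pairs $i < j$ of consecutive hits.
  If at least two letters lie outside the windows, exchanging two of them reverses the sign; if exactly
  one does, cyclically rotating the $n - 1$ (an even number of) values inside the windows reverses the
  sign and preserves hits. Only the pair $(0, d)$ survives. As $n$ is odd, rotating all values
  preserves the sign, so this term is $n$ times the contribution of the permutations $A B C$
  with $|A| = |C| = d$ and $B = 1 2 \cdots (c - d)$. There $A$ and $C$ are increasing and the absence
  of hits strictly between $0$ and $d$ says $a_{i+1} < c_i$: the shuffle of $A$ and $C$ is a ballot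
  sequence. Removing the largest letter gives a recursion for the signed number of such
  shuffles, whose solution at $d$ is a Catalan number.\<close>

subsection \<open>Inversions\<close>

fun invl :: "nat list \<Rightarrow> nat" where
  "invl [] = 0"
| "invl (x # xs) = length (filter (\<lambda>y. y < x) xs) + invl xs"

lemma inversions_eq_invl: "inversions p = invl p"
proof (induction p)
  case Nil
  then show ?case by (simp add: inversions_def)
next
  case (Cons x xs)
  let ?I = "\<lambda>p. {(i, j). i < j \<and> j < length p \<and> p ! i > (p ! j :: nat)}"
  let ?J = "{j. j < length xs \<and> xs ! j < x}"
  have fin: "finite (?I p)" for p :: "nat list"
    by (rule finite_subset[of _ "{..<length p} \<times> {..<length p}"]) auto
  have eq: "?I (x # xs) = (\<lambda>j. (0, Suc j)) ` ?J \<union> (\<lambda>(i, j). (Suc i, Suc j)) ` ?I xs" (is "?L = ?R")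
  proof
    show "?L \<subseteq> ?R"
    proof
      fix z assume z: "z \<in> ?L"
      obtain i j where ij: "z = (i, j)" by (cases z)
      with z obtain j' where j': "j = Suc j'" by (cases j) auto
      show "z \<in> ?R"
      proof (cases i)
        case 0
        then show ?thesis using z ij j' by auto
      next
        case (Suc i')
        then have "(i', j') \<in> ?I xs" using z ij j' by auto
        then show ?thesis using Suc ij j' by force
      qed
    qed
  qed auto
  have "card (?I (x # xs)) = card ?J + card (?I xs)"
    unfolding eq
    by (subst card_Un_disjoint) (auto simp: fin card_image inj_on_def)
  then show ?case using Cons.IH
    by (simp add: inversions_def length_filter_conv_card)
qed

lemma invl_insert:
  "invl (xs @ a # ys) = invl (xs @ ys) + length (filter (\<lambda>x. a < x) xs) + length (filter (\<lambda>y. y < a) ys)"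
  by (induction xs) auto

lemma length_filter_less_greater:
  fixes a :: nat
  assumes "a \<notin> set ys"
  shows "length (filter (\<lambda>x. a < x) ys) + length (filter (\<lambda>y. y < a) ys) = length ys"
  using assms by (induction ys) auto

text \<open>Outer letters contribute equally to both words. Over the two words together, each letter
  of \<open>ys\<close> is counted once against \<open>a\<close> and once against \<open>b\<close>,
  while \<open>a\<close> and \<open>b\<close> themselves are inverted in exactly one word.\<close>

lemma invl_swap:
  assumes "distinct (xs @ a # ys @ b # zs)"
  shows "odd (invl (xs @ a # ys @ b # zs) + invl (xs @ b # ys @ a # zs))"
proof -
  let ?g = "\<lambda>a xs. length (filter (\<lambda>x::nat. a < x) xs)"
  let ?l = "\<lambda>a xs. length (filter (\<lambda>x::nat. x < a) xs)"
  have *: "invl (xs @ a # ys @ b # zs) = invl (xs @ ys @ zs) + ?g b xs + ?g b ys + ?l b zs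
      + ?g a xs + ?l a ys + ?l a zs + (if b < a then 1 else 0)" for a b
    using invl_insert[of xs a "ys @ b # zs"] invl_insert[of "xs @ ys" b zs] by simp
  have "?g a ys + ?l a ys = length ys" "?g b ys + ?l b ys = length ys"
    using assms by (auto intro!: length_filter_less_greater)
  moreover have "a \<noteq> b" using assms by auto
  ultimately have "invl (xs @ a # ys @ b # zs) + invl (xs @ b # ys @ a # zs) =
     2 * (invl (xs @ ys @ zs) + ?g b xs + ?l b zs + ?g a xs + ?l a zs + length ys) + 1"
    using *[of a b] *[of b a] by auto
  then show ?thesis by simp
qed

lemma length_filter_mset_cong:
  assumes "mset q = mset q'"
  shows "length (filter P q) = length (filter P q')"
  using assms by (metis mset_filter size_mset)

text \<open>Inversions between a block and its surroundings depend only on the letters of the block,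
  not on their order. The additive form avoids subtraction on naturals; it lets a sign change be
  computed inside the block.\<close>

lemma invl_append_mset:
  assumes "mset q = mset q'"
  shows "invl (l @ q @ r) + invl q' = invl (l @ q' @ r) + invl q"
proof (induction l)
  case Nil
  show ?case
  proof (induction r rule: rev_induct)
    case (snoc x r)
    have "invl (q @ r @ [x]) = invl (q @ r) + length (filter (\<lambda>y. x < y) (q @ r))" for q
      using invl_insert[of "q @ r" x "[]"] by simp
    then show ?case using snoc length_filter_mset_cong[OF assms] by simp
  qed simp
next
  case (Cons x l)
  then show ?case using length_filter_mset_cong[OF assms] by simp
qed

lemma invl_map_strict_mono:
  assumes "strict_mono_on (set q) f"
  shows "invl (map f q) = invl q"
  using assms
proof (induction q)
  case (Cons x q)
  have "strict_mono_on (set q) f" using Cons.prems by (auto simp: strict_mono_on_def)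
  moreover have "filter (\<lambda>y. f y < f x) q = filter (\<lambda>y. y < x) q"
  proof (rule filter_cong[OF refl])
    fix y assume "y \<in> set q"
    then show "(f y < f x) = (y < x)"
      using strict_mono_on_less[OF Cons.prems, of y x] by simp
  qed
  ultimately show ?case using Cons.IH by (simp add: filter_map o_def)
qed simp

lemma invl_sorted: "sorted xs \<Longrightarrow> invl xs = 0"
  by (induction xs) (auto simp: filter_empty_conv not_less)

lemma invl_insert_below:
  assumes "sorted B" "\<forall>b\<in>set B. \<forall>x\<in>set (A @ C). b < x"
  shows "invl (A @ B @ C) = invl (A @ C) + length A * length B"
  using assms
proof (induction B)
  case (Cons b B)
  have "filter (\<lambda>x. b < x) A = A" "filter (\<lambda>y. y < b) (B @ C) = []"
    using Cons.prems by (auto simp: filter_id_conv filter_empty_conv not_less intro: less_imp_le)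
  then show ?case using Cons invl_insert[of A b "B @ C"] by simp
qed simp

subsection \<open>Cyclically increasing words\<close>

text \<open>The letters of a block need not form an interval, so adding 1 cyclically is replaced by
  the cyclic successor within \<open>V\<close>.\<close>

definition next_in :: "nat set \<Rightarrow> nat \<Rightarrow> nat" where
  "next_in V x = (if x = Max V then Min V else Min {y \<in> V. x < y})"

lemma next_in_gt:
  assumes "finite V" "x \<in> V" "x \<noteq> Max V"
  shows "next_in V x \<in> V" "x < next_in V x" "y \<in> V \<Longrightarrow> x < y \<Longrightarrow> next_in V x \<le> y"
proof -
  have "Max V \<in> {y \<in> V. x < y}" using assms
    by (metis (no_types, lifting) Max_ge Max_in empty_iff le_neq_trans mem_Collect_eq)
  then have "Min {y \<in> V. x < y} \<in> {y \<in> V. x < y}"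
    using assms by (intro Min_in) auto
  then show "next_in V x \<in> V" "x < next_in V x" using assms by (auto simp: next_in_def)
  show "next_in V x \<le> y" if "y \<in> V" "x < y"
    using that assms by (auto simp: next_in_def)
qed

lemma next_in_mem:
  assumes "finite V" "x \<in> V"
  shows "next_in V x \<in> V"
  using assms next_in_gt(1)[OF assms] by (cases "x = Max V") (auto simp: next_in_def intro!: Min_in)

lemma next_in_strict_mono:
  assumes "finite V"
  shows "strict_mono_on (V - {Max V}) (next_in V)"
proof (rule strict_mono_onI)
  fix x y assume "x \<in> V - {Max V}" "y \<in> V - {Max V}" "x < y"
  then show "next_in V x < next_in V y"
    using next_in_gt(3)[OF assms, of x y] next_in_gt(2)[OF assms, of y] by auto
qed

lemma next_in_Max_less:
  assumes "finite V" "x \<in> V" "x \<noteq> Max V"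
  shows "next_in V (Max V) < next_in V x"
  using next_in_gt(2)[OF assms] assms
  by (simp add: next_in_def) (meson Min_le le_less_trans)

lemma inj_on_next_in:
  assumes "finite V"
  shows "inj_on (next_in V) V"
proof (rule inj_onI)
  fix x y assume *: "x \<in> V" "y \<in> V" "next_in V x = next_in V y"
  show "x = y"
  proof (cases "x = Max V \<or> y = Max V")
    case True
    then show ?thesis using * next_in_Max_less[OF assms] by (metis less_irrefl)
  next
    case False
    then show ?thesis using * strict_mono_on_imp_inj_on[OF next_in_strict_mono[OF assms]]
      by (auto dest!: inj_onD)
  qed
qed

lemma next_in_image:
  assumes "finite V"
  shows "next_in V ` V = V"
  using assms by (intro endo_inj_surj inj_on_next_in) (auto intro: next_in_mem)

lemma next_in_interval:
  assumes "1 \<le> v" "v < n"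
  shows "next_in {1..n} v = v + 1"
proof -
  have "Max {1..n} = n" using assms by (intro Max_eqI) auto
  moreover have "Min {y \<in> {1..n}. v < y} = v + 1" using assms by (intro Min_eqI) auto
  ultimately show ?thesis using assms by (simp add: next_in_def)
qed

text \<open>The maximum is inverted with everything to its right; its image, the minimum, is
  inverted with everything to its left. All other letters keep their relative order, so the parity
  changes by the number of other letters.\<close>

lemma invl_map_next_in:
  assumes "distinct q" "q \<noteq> []"
  shows "even (invl (map (next_in (set q)) q) + invl q + (length q - 1))"
proof -
  define M where "M = Max (set q)"
  let ?f = "next_in (set q)"
  have "M \<in> set q" using assms by (simp add: M_def)
  then obtain xs ys where q: "q = xs @ M # ys" by (meson split_list)
  have sub: "set (xs @ ys) = set q - {M}" using assms q by auto
  have lt: "x < M" if "x \<in> set (xs @ ys)" for x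
  proof -
    have "x \<in> set q" "x \<noteq> M" using that sub by auto
    then show ?thesis unfolding M_def by (simp add: order.not_eq_order_implies_strict)
  qed
  have f_gt: "?f M < ?f x" if "x \<in> set (xs @ ys)" for x
    using that sub next_in_Max_less[of "set q" x] by (auto simp: M_def)
  have "invl q = invl (xs @ ys) + length ys"
  proof -
    have "filter (\<lambda>x. M < x) xs = []" "filter (\<lambda>y. y < M) ys = ys"
      using lt by (auto simp: filter_empty_conv filter_id_conv dest: less_asym)
    then show ?thesis unfolding q by (simp add: invl_insert)
  qed
  moreover have "invl (map ?f q) = invl (map ?f (xs @ ys)) + length xs"
  proof -
    have "filter (\<lambda>x. ?f M < x) (map ?f xs) = map ?f xs" "filter (\<lambda>y. y < ?f M) (map ?f ys) = []"
      using f_gt by (auto simp: filter_empty_conv filter_id_conv dest: less_asym)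
    then have "invl (map ?f xs @ ?f M # map ?f ys) = invl (map ?f (xs @ ys)) + length xs"
      by (simp add: invl_insert)
    moreover have "map ?f q = map ?f xs @ ?f M # map ?f ys" by (subst (2) q) simp
    ultimately show ?thesis by simp
  qed
  moreover have "invl (map ?f (xs @ ys)) = invl (xs @ ys)"
    using next_in_strict_mono[of "set q"] by (intro invl_map_strict_mono) (simp only: sub M_def finite_set)
  moreover have "length q - 1 = length xs + length ys" using q by simp
  ultimately have "invl (map ?f q) + invl q + (length q - 1) = 2 * (invl (xs @ ys) + length xs + length ys)"
    by simp
  then show ?thesis by simp
qed

text \<open>The condition for a hit without standardization; \<open>std_in_cyc_shifts_iff\<close>
  gives the link. Cutting the word in two replaces an explicit rotation count.\<close>

definition cyc_sorted :: "nat list \<Rightarrow> bool" where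
  "cyc_sorted u \<longleftrightarrow> (\<exists>xs ys. u = xs @ ys \<and> sorted (ys @ xs))"

lemma cyc_sorted_append_commute: "cyc_sorted (xs @ ys) = cyc_sorted (ys @ xs)"
proof -
  have "cyc_sorted (ys @ xs)" if "cyc_sorted (xs @ ys)" for xs ys
  proof -
    from that obtain us vs where *: "xs @ ys = us @ vs" "sorted (vs @ us)"
      by (auto simp: cyc_sorted_def)
    \<comment> \<open>The two factorizations of one word overlap in \<open>zs\<close>: the cut of
      the sorted rotation falls inside \<open>ys\<close> or inside \<open>xs\<close>.\<close>
    from *(1) consider zs where "us = xs @ zs" "ys = zs @ vs" | zs where "xs = us @ zs" "vs = zs @ ys"
      by (auto simp: append_eq_append_conv2)
    then show ?thesis
    proof cases
      case 1
      then have "ys @ xs = zs @ (vs @ xs)" "sorted ((vs @ xs) @ zs)" using * by auto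
      then show ?thesis unfolding cyc_sorted_def by blast
    next
      case 2
      then have "ys @ xs = (ys @ us) @ zs" "sorted (zs @ (ys @ us))" using * by auto
      then show ?thesis unfolding cyc_sorted_def by blast
    qed
  qed
  then show ?thesis by blast
qed

lemma cyc_sorted_iff_rotate: "cyc_sorted u \<longleftrightarrow> (\<exists>k. sorted (rotate k u))"
proof
  assume "cyc_sorted u"
  then obtain xs ys where "u = xs @ ys" "sorted (ys @ xs)" by (auto simp: cyc_sorted_def)
  then show "\<exists>k. sorted (rotate k u)" by (metis rotate_append)
next
  assume "\<exists>k. sorted (rotate k u)"
  then obtain k where "sorted (rotate k u)" ..
  then show "cyc_sorted u"
    unfolding cyc_sorted_def rotate_drop_take
    by (metis append_take_drop_id)
qed

text \<open>A nontrivial cut would place a letter of \<open>vs\<close> before \<open>x\<close> in a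
  sorted word, hence at most \<open>x\<close>. This turns the cyclic condition into plain sortedness
  once a window is rotated to begin with 1.\<close>

lemma cyc_sorted_Min_Cons:
  assumes "\<forall>y\<in>set xs. x < y"
  shows "cyc_sorted (x # xs) \<longleftrightarrow> sorted (x # xs)"
proof
  assume "cyc_sorted (x # xs)"
  then obtain us vs where *: "x # xs = us @ vs" "sorted (vs @ us)" by (auto simp: cyc_sorted_def)
  show "sorted (x # xs)"
  proof (cases us)
    case Nil
    then show ?thesis using * by simp
  next
    case (Cons a us')
    with *(1) have a: "a = x" "xs = us' @ vs" by simp_all
    have "vs = []"
    proof (rule ccontr)
      assume "vs \<noteq> []"
      then have "hd vs \<in> set vs" by simp
      then have "hd vs \<le> x" "x < hd vs" using *(2) Cons a assms by (auto simp: sorted_append)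
      then show False by simp
    qed
    then show ?thesis using * by simp
  qed
next
  assume "sorted (x # xs)"
  then show "cyc_sorted (x # xs)" unfolding cyc_sorted_def by (metis append_Nil append_Nil2)
qed

lemma sorted_map_strict_mono:
  assumes "strict_mono_on (set q) f" "sorted q"
  shows "sorted (map f q)"
  using assms by (metis sorted_map_mono strict_mono_on_imp_mono_on)

text \<open>Rotate \<open>u\<close> until it is sorted. Then \<open>next_in V\<close> preserves the
  order except at \<open>Max V\<close>, which can only be the last letter; its image is the minimum
  of \<open>V\<close>, so moving it to the front restores sortedness.\<close>

lemma cyc_sorted_map_next_in:
  assumes "finite V" "set u \<subseteq> V" "distinct u" "cyc_sorted u"
  shows "cyc_sorted (map (next_in V) u)"
proof -
  let ?f = "next_in V"
  obtain xs ys where u: "u = xs @ ys" and s: "sorted (ys @ xs)" using assms(4) by (auto simp: cyc_sorted_def)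
  have "cyc_sorted (map ?f (ys @ xs))"
  proof (cases "Max V \<in> set (ys @ xs)")
    case False
    then have "set (ys @ xs) \<subseteq> V - {Max V}" using assms(2) u by auto
    then have "strict_mono_on (set (ys @ xs)) ?f"
      using next_in_strict_mono[OF assms(1)] unfolding strict_mono_on_def by blast
    then have "sorted (map ?f (ys @ xs))" using s sorted_map_strict_mono by blast
    then show ?thesis by (metis append_Nil append_Nil2 cyc_sorted_def)
  next
    case True
    then obtain zs ws where split: "ys @ xs = zs @ Max V # ws" by (meson split_list)
    have d: "distinct (zs @ Max V # ws)" using split assms(3) u by (metis distinct_append Int_commute)
    have sub: "set (zs @ Max V # ws) \<subseteq> V" using assms(2) u split by (metis Un_commute set_append)
    have "ws = []"
    proof (rule ccontr)
      assume "ws \<noteq> []"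
      then have w: "hd ws \<in> set ws" by simp
      then have "Max V \<le> hd ws" using s split by (auto simp: sorted_append)
      moreover have "hd ws \<le> Max V" using w sub assms(1) by auto
      ultimately show False using w d by auto
    qed
    have zs: "set zs \<subseteq> V - {Max V}" using d sub by auto
    then have "strict_mono_on (set zs) ?f"
      using next_in_strict_mono[OF assms(1)] by (auto simp: strict_mono_on_def)
    then have "sorted (map ?f zs)"
      using s split sorted_map_strict_mono by (auto simp: sorted_append)
    moreover have "\<forall>z\<in>set zs. ?f (Max V) \<le> ?f z"
      using zs next_in_Max_less[OF assms(1)] by (auto intro!: less_imp_le)
    ultimately have "sorted ([?f (Max V)] @ map ?f zs)" by simp
    then have "cyc_sorted (map ?f zs @ [?f (Max V)])" unfolding cyc_sorted_def by blast
    then show ?thesis using split \<open>ws = []\<close> by simp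
  qed
  then show ?thesis using cyc_sorted_append_commute[of "map ?f ys" "map ?f xs"] u by simp
qed

section \<open>Standardization of cyclic shifts\<close>

lemma std_rotate: "std (rotate k u) = rotate k (std u)"
  by (simp add: std_def rotate_map)

lemma std_sorted:
  assumes "sorted u" "distinct u"
  shows "std u = [1..<length u + 1]"
proof (rule nth_equalityI)
  fix i assume "i < length (std u)"
  then have i: "i < length u" by (simp add: std_def)
  have "{y \<in> set u. y \<le> u ! i} = (!) u ` {..i}"
  proof (intro equalityI subsetI)
    fix y assume "y \<in> {y \<in> set u. y \<le> u ! i}"
    then obtain j where j: "j < length u" "y = u ! j" "u ! j \<le> u ! i" by (auto simp: in_set_conv_nth)
    have "j \<le> i"
    proof (rule ccontr)
      assume "\<not> j \<le> i"
      then have "u ! i \<le> u ! j" "i \<noteq> j" using assms(1) j(1) by (simp_all add: sorted_iff_nth_mono)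
      then show False using j i assms(2) by (simp add: nth_eq_iff_index_eq)
    qed
    then show "y \<in> (!) u ` {..i}" using j by simp
  next
    fix y assume "y \<in> (!) u ` {..i}"
    then show "y \<in> {y \<in> set u. y \<le> u ! i}"
      using i assms(1) by (auto simp: sorted_iff_nth_mono)
  qed
  moreover have "inj_on ((!) u) {..i}" using i assms(2) by (auto simp: inj_on_def nth_eq_iff_index_eq)
  ultimately show "std u ! i = [1..<length u + 1] ! i" using i by (simp add: std_def card_image del: upt_Suc)
qed (simp add: std_def del: upt_Suc)

lemma sorted_if_std_sorted:
  assumes "sorted (std u)"
  shows "sorted u"
  unfolding sorted_iff_nth_mono
proof (intro allI impI)
  fix i j assume ij: "i \<le> j" "j < length u"
  show "u ! i \<le> u ! j"
  proof (rule ccontr)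
    assume "\<not> u ! i \<le> u ! j"
    then have lt: "u ! j < u ! i" by simp
    have "{y \<in> set u. y \<le> u ! j} \<subset> {y \<in> set u. y \<le> u ! i}"
    proof
      show "{y \<in> set u. y \<le> u ! j} \<subseteq> {y \<in> set u. y \<le> u ! i}" using lt by auto
      have "u ! i \<in> {y \<in> set u. y \<le> u ! i} - {y \<in> set u. y \<le> u ! j}" using lt ij by simp
      then show "{y \<in> set u. y \<le> u ! j} \<noteq> {y \<in> set u. y \<le> u ! i}" by blast
    qed
    then have "card {y \<in> set u. y \<le> u ! j} < card {y \<in> set u. y \<le> u ! i}"
      by (intro psubset_card_mono) auto
    then have "std u ! j < std u ! i" using ij by (simp add: std_def)
    moreover have "std u ! i \<le> std u ! j"
      using assms ij sorted_nth_mono[of "std u" i j] by (simp add: std_def)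
    ultimately show False by simp
  qed
qed

text \<open>Standardization commutes with rotation and detects sortedness, so both sides say that
  some rotation of \<open>u\<close> is sorted.\<close>

lemma std_in_cyc_shifts_iff:
  assumes "distinct u" "length u = c" "0 < c"
  shows "std u \<in> cyc_shifts c \<longleftrightarrow> cyc_sorted u"
proof
  assume "std u \<in> cyc_shifts c"
  then obtain k where k: "k < c" "std u = rotate k [1..<c+1]" by (auto simp: cyc_shifts_def)
  have "std (rotate (c - k) u) = rotate (c - k + k) [1..<c+1]"
    unfolding std_rotate k(2) rotate_rotate ..
  also have "\<dots> = [1..<c+1]" using k(1) by (intro rotate_id) auto
  finally have "sorted (std (rotate (c - k) u))" by (simp only: sorted_upt)
  then have "sorted (rotate (c - k) u)" by (rule sorted_if_std_sorted)
  then show "cyc_sorted u" unfolding cyc_sorted_iff_rotate ..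
next
  assume "cyc_sorted u"
  then obtain k' where k': "sorted (rotate k' u)" unfolding cyc_sorted_iff_rotate ..
  define k where "k = k' mod c"
  have k: "k < c" "sorted (rotate k u)"
    using k' assms by (simp_all add: k_def rotate_conv_mod[of k'])
  have "rotate k (std u) = [1..<c+1]"
    using std_sorted[of "rotate k u"] k assms by (simp add: std_rotate)
  then have "rotate (c - k) [1..<c+1] = rotate (c - k + k) (std u)"
    unfolding rotate_rotate[symmetric] by simp
  also have "\<dots> = std u" using k(1) assms by (intro rotate_id) (simp add: std_def)
  \<comment> \<open>\<open>cyc_shifts\<close> admits only shifts below \<open>c\<close>; for
    \<open>k = 0\<close> the shift \<open>c - k\<close> would be \<open>c\<close> itself.\<close>
  finally have "std u = rotate ((c - k) mod c) [1..<c+1]"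
    by (subst (asm) rotate_conv_mod) (simp del: upt_Suc)
  moreover have "(c - k) mod c < c" using assms(3) by simp
  ultimately show "std u \<in> cyc_shifts c" unfolding cyc_shifts_def by blast
qed

subsection \<open>Consecutive hits\<close>

text \<open>Positions are 0-based and not bounded here; a window running past the end would be cut
  short. The final argument only uses positions up to \<open>n - c\<close>.\<close>

definition hit :: "nat \<Rightarrow> nat \<Rightarrow> nat list \<Rightarrow> bool" where
  "hit c i p \<longleftrightarrow> cyc_sorted (take c (drop i p))"

definition psign :: "nat list \<Rightarrow> int" where
  "psign p = (- 1) ^ invl p"

text \<open>Hits before \<open>i\<close> or after \<open>j\<close> remain unrestricted. For
  \<open>i = j\<close> the last condition is vacuous, so single hits and consecutive pairs share the
  same cancellation lemmas.\<close>

definition consec_hits :: "nat \<Rightarrow> nat \<Rightarrow> nat \<Rightarrow> nat \<Rightarrow> nat list set" where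
  "consec_hits c n i j = {p \<in> perms n. hit c i p \<and> hit c j p \<and> (\<forall>k. i < k \<and> k < j \<longrightarrow> \<not> hit c k p)}"

lemma perms_length: "p \<in> perms n \<Longrightarrow> length p = n"
  unfolding perms_def using distinct_card[of p] by auto

lemma finite_perms: "finite (perms n)"
proof (rule finite_subset)
  show "perms n \<subseteq> {p. set p \<subseteq> {1..n} \<and> length p = n}"
    using perms_length by (auto simp: perms_def)
qed (simp add: finite_lists_length_eq)

lemma finite_consec_hits: "finite (consec_hits c n i j)"
  unfolding consec_hits_def using finite_perms by auto

lemma has_hit_iff:
  assumes "p \<in> perms n" "0 < c" "c \<le> n"
  shows "has_hit c p \<longleftrightarrow> (\<exists>i\<le>n - c. hit c i p)"
proof -
  have len: "length p = n" using assms perms_length by auto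
  have "std (take c (drop i p)) \<in> cyc_shifts c \<longleftrightarrow> hit c i p" if "i + c \<le> n" for i
    unfolding hit_def
    using assms that len by (intro std_in_cyc_shifts_iff) (auto simp: perms_def)
  then show ?thesis unfolding has_hit_def len using assms(3)
    by (metis le_diff_conv le_diff_conv2)
qed

section \<open>Signed sums over single hits and consecutive pairs\<close>

lemma psign_sum_diff:
  assumes "finite S"
  shows "int (card {p \<in> S. \<not> odd_perm p}) - int (card {p \<in> S. odd_perm p}) = (\<Sum>p\<in>S. psign p)"
proof -
  have "(\<Sum>p\<in>S. psign p) = (\<Sum>p\<in>{p \<in> S. \<not> odd_perm p}. psign p) + (\<Sum>p\<in>{p \<in> S. odd_perm p}. psign p)"
    using assms by (subst sum.union_disjoint[symmetric]) (auto intro!: sum.cong)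
  also have "(\<Sum>p\<in>{p \<in> S. \<not> odd_perm p}. psign p) = (\<Sum>p\<in>{p \<in> S. \<not> odd_perm p}. 1)"
    by (rule sum.cong) (auto simp: psign_def odd_perm_def inversions_eq_invl)
  also have "(\<Sum>p\<in>{p \<in> S. odd_perm p}. psign p) = (\<Sum>p\<in>{p \<in> S. odd_perm p}. - 1)"
    by (rule sum.cong) (auto simp: psign_def odd_perm_def inversions_eq_invl)
  finally show ?thesis by simp
qed

text \<open>With \<open>S = T\<close> and \<open>e = - 1\<close> the signed sum cancels; with
  \<open>e = 1\<close> two signed sums agree. All three sign arguments below go through
  this.\<close>

lemma sum_psign_scale:
  assumes "bij_betw f S T" "\<And>p. p \<in> S \<Longrightarrow> psign (f p) = e * psign p"
  shows "(\<Sum>p\<in>T. psign p) = e * (\<Sum>p\<in>S. psign p)"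
proof -
  have "(\<Sum>p\<in>T. psign p) = (\<Sum>p\<in>S. psign (f p))"
    using assms(1) by (rule sum.reindex_bij_betw[symmetric])
  also have "\<dots> = (\<Sum>p\<in>S. e * psign p)" using assms(2) by (rule sum.cong[OF refl])
  finally show ?thesis by (simp add: sum_distrib_left)
qed

text \<open>Induction on \<open>d\<close>: a new element \<open>Suc d\<close> adds 1 and, if there
  are earlier elements, takes away 1 for its pair with the nearest of them. Either way the total
  becomes 1.\<close>

lemma of_bool_ex_eq_consecutive:
  fixes P :: "nat \<Rightarrow> bool"
  shows "of_bool (\<exists>i\<le>d. P i) = (\<Sum>j\<le>d. of_bool (P j) -
    (\<Sum>i<j. of_bool (P i \<and> P j \<and> (\<forall>k. i < k \<and> k < j \<longrightarrow> \<not> P k))) :: int)"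
proof (induction d)
  case 0
  then show ?case by simp
next
  case (Suc d)
  let ?c = "\<lambda>i. P i \<and> (\<forall>k. i < k \<and> k < Suc d \<longrightarrow> \<not> P k)"
  have last: "(\<Sum>i<Suc d. of_bool (?c i)) = (of_bool (\<exists>i\<le>d. P i) :: int)"
  proof (cases "\<exists>i\<le>d. P i")
    case True
    \<comment> \<open>Only the largest earlier element is consecutive to \<open>Suc d\<close>, so
      the sum has a single nonzero term.\<close>
    define m where "m = Max {i. i \<le> d \<and> P i}"
    have fin: "finite {i. i \<le> d \<and> P i}" by simp
    have "m \<in> {i. i \<le> d \<and> P i}" unfolding m_def using True by (intro Max_in fin) auto
    then have m: "m \<le> d" "P m" by auto
    have ge: "i \<le> m" if "i \<le> d" "P i" for i unfolding m_def using that by (intro Max_ge fin) auto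
    have "?c i \<longleftrightarrow> i = m" if "i < Suc d" for i
      using m ge that by (metis less_Suc_eq_le linorder_neqE_nat not_le)
    then have "(\<Sum>i<Suc d. of_bool (?c i)) = (\<Sum>i<Suc d. if i = m then 1 else (0::int))"
      by (intro sum.cong) auto
    also have "\<dots> = 1" using m by simp
    finally show ?thesis using True by simp
  next
    case False
    then show ?thesis by (auto intro!: sum.neutral)
  qed
  show ?case
  proof (cases "P (Suc d)")
    case True
    have "(\<Sum>i<Suc d. of_bool (P i \<and> P (Suc d) \<and> (\<forall>k. i < k \<and> k < Suc d \<longrightarrow> \<not> P k))) =
        (of_bool (\<exists>i\<le>d. P i) :: int)"
      using last True by simp
    moreover have "of_bool (\<exists>i\<le>Suc d. P i) = (1 :: int)" using True by auto
    ultimately show ?thesis using True by (simp only: sum.atMost_Suc flip: Suc) simp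
  next
    case False
    then have "(\<exists>i\<le>Suc d. P i) \<longleftrightarrow> (\<exists>i\<le>d. P i)" by (auto simp: le_Suc_eq)
    then show ?thesis using False by (simp only: sum.atMost_Suc flip: Suc) simp
  qed
qed

text \<open>The indicator identity is multiplied by the sign, and the sums over permutations and
  over positions are exchanged.\<close>

lemma psign_sum_non_avoiders:
  "(\<Sum>p\<in>{p \<in> perms n. \<exists>i\<le>d. hit c i p}. psign p) =
   (\<Sum>j\<le>d. (\<Sum>p\<in>consec_hits c n j j. psign p) - (\<Sum>i<j. \<Sum>p\<in>consec_hits c n i j. psign p))"
proof -
  have restrict: "(\<Sum>p\<in>{p \<in> perms n. Q p}. psign p) = (\<Sum>p\<in>perms n. psign p * of_bool (Q p))" for Q
    unfolding of_bool_def by (subst sum.inter_filter[OF finite_perms]) (auto intro!: sum.cong)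
  have single: "consec_hits c n j j = {p \<in> perms n. hit c j p}" for j
    by (auto simp: consec_hits_def)
  show ?thesis
    unfolding single unfolding consec_hits_def restrict of_bool_ex_eq_consecutive
    by (simp add: sum_distrib_left right_diff_distrib sum_subtractf sum.swap[of _ "perms n"] mult.commute)
qed

section \<open>Cancellation by exchanging two letters\<close>

lemma psign_swap:
  assumes "distinct p" "s < t" "t < length p"
  shows "psign (p[s := p ! t, t := p ! s]) = - psign p"
proof -
  define xs ys zs where "xs = take s p" and "ys = take (t - s - 1) (drop (s + 1) p)" and "zs = drop (t + 1) p"
  have p: "p = xs @ p ! s # ys @ p ! t # zs"
  proof -
    have "drop (s + 1) p = ys @ drop (t - s - 1) (drop (s + 1) p)"
      unfolding ys_def by (rule append_take_drop_id[symmetric])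
    also have "drop (t - s - 1) (drop (s + 1) p) = p ! t # zs"
      using assms by (simp add: zs_def Cons_nth_drop_Suc)
    finally show ?thesis using assms id_take_nth_drop[of s p] by (simp add: xs_def)
  qed
  have len: "length xs = s" "length ys = t - s - 1" using assms by (auto simp: xs_def ys_def)
  have upd: "(xs @ a # ys @ b # zs)[s := b, t := a] = xs @ b # ys @ a # zs" for a b
  proof -
    have "(xs @ a # ys @ b # zs)[s := b] = (xs @ b # ys) @ b # zs" using len by auto
    moreover have "length (xs @ b # ys) = t" using len assms by simp
    then have "((xs @ b # ys) @ b # zs)[t := a] = (xs @ b # ys) @ a # zs" by (metis list_update_length)
    ultimately show ?thesis by simp
  qed
  have swapped: "p[s := p ! t, t := p ! s] = xs @ p ! t # ys @ p ! s # zs"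
    using upd[of "p ! s" "p ! t"] p by metis
  have "odd (invl p + invl (p[s := p ! t, t := p ! s]))"
    using invl_swap[of xs "p ! s" ys "p ! t" zs] assms(1) p swapped by metis
  then show ?thesis by (auto simp: psign_def uminus_power_if)
qed

text \<open>The hypotheses put \<open>s\<close> and \<open>t\<close> outside the stretch covered by
  the windows at \<open>i\<close> to \<open>j\<close>, so the exchange leaves all these windows
  intact and is a sign-reversing involution.\<close>

lemma consec_hits_sum_swap:
  assumes "i \<le> j" "s < t" "t < n" "s < i \<or> j + c \<le> s" "t < i \<or> j + c \<le> t" "j + c \<le> n"
  shows "(\<Sum>p\<in>consec_hits c n i j. psign p) = 0"
proof -
  let ?f = "\<lambda>p :: nat list. p[s := p ! t, t := p ! s]"
  have hit: "hit c k (?f p) = hit c k p" if "p \<in> perms n" "i \<le> k" "k \<le> j" for p k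
  proof -
    have "take c (drop k (?f p)) = take c (drop k p)"
    proof (rule nth_equalityI)
      fix l assume "l < length (take c (drop k (?f p)))"
      then show "take c (drop k (?f p)) ! l = take c (drop k p) ! l"
        using assms that perms_length[OF that(1)] by (auto simp: nth_list_update)
    qed simp
    then show ?thesis by (simp add: hit_def)
  qed
  have mem: "?f p \<in> perms n" if "p \<in> perms n" for p
    using that assms perms_length[OF that] by (auto simp: perms_def)
  have inv: "?f (?f p) = p" if "p \<in> perms n" for p
    using assms perms_length[OF that] by (intro nth_equalityI) (auto simp: nth_list_update)
  have maps: "?f p \<in> consec_hits c n i j" if "p \<in> consec_hits c n i j" for p
    using that mem[of p] hit[of p] assms(1) by (auto simp: consec_hits_def)
  have "bij_betw ?f (consec_hits c n i j) (consec_hits c n i j)"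
    using maps inv by (intro bij_betw_byWitness[where f' = ?f]) (auto simp: consec_hits_def)
  moreover have "psign (?f p) = (- 1) * psign p" if "p \<in> consec_hits c n i j" for p
    using that psign_swap[of p s t] assms perms_length[of p n] by (auto simp: consec_hits_def perms_def)
  ultimately have "(\<Sum>p\<in>consec_hits c n i j. psign p) = (- 1) * (\<Sum>p\<in>consec_hits c n i j. psign p)"
    by (rule sum_psign_scale)
  then show ?thesis by simp
qed

section \<open>Rotating the values inside a block\<close>

definition rotate_values :: "nat \<Rightarrow> nat \<Rightarrow> nat list \<Rightarrow> nat list" where
  "rotate_values i m p =
    (let q = take m (drop i p) in take i p @ map (next_in (set q)) q @ drop (i + m) p)"

lemma split3: "p = take i p @ take m (drop i p) @ drop (i + m) p"
  by (metis add.commute append_take_drop_id drop_drop)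

lemma mset_map_next_in:
  assumes "distinct q"
  shows "mset (map (next_in (set q)) q) = mset q"
proof -
  have "distinct (map (next_in (set q)) q)"
    using assms by (simp add: distinct_map inj_on_next_in)
  moreover have "set (map (next_in (set q)) q) = set q" by (simp add: next_in_image)
  ultimately show ?thesis using assms set_eq_iff_mset_eq_distinct by blast
qed

lemma rotate_values_perms:
  assumes "p \<in> perms n"
  shows "rotate_values i m p \<in> perms n"
proof -
  let ?q = "take m (drop i p)"
  have "mset (rotate_values i m p) = mset (take i p @ ?q @ drop (i + m) p)"
    using assms by (simp add: rotate_values_def Let_def mset_map_next_in perms_def del: mset_map)
  then have "mset (rotate_values i m p) = mset p" using split3[of p i m] by metis
  then show ?thesis using assms unfolding perms_def
    by (metis (mono_tags, lifting) mem_Collect_eq mset_eq_imp_distinct_iff mset_eq_setD)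
qed

text \<open>Outer letters are unchanged, and the rotation permutes the value set of the block. That
  set can therefore be read off the image, and then a single injective map is undone.\<close>

lemma inj_on_rotate_values: "inj_on (rotate_values i m) (perms n)"
proof (rule inj_onI)
  fix p p' assume p: "p \<in> perms n" "p' \<in> perms n" and eq: "rotate_values i m p = rotate_values i m p'"
  let ?q = "take m (drop i p)" and ?q' = "take m (drop i p')"
  have len: "length p = length p'" using p perms_length by metis
  have *: "take i p = take i p'" "map (next_in (set ?q)) ?q = map (next_in (set ?q')) ?q'"
    "drop (i + m) p = drop (i + m) p'"
    using eq len by (auto simp: rotate_values_def Let_def append_eq_append_conv)
  have "set (map (next_in (set ?q)) ?q) = set (map (next_in (set ?q')) ?q')" using *(2) by simp
  then have seq: "set ?q = set ?q'" by (simp only: set_map next_in_image finite_set)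
  have "?q = ?q'"
  proof (rule map_inj_on)
    show "map (next_in (set ?q)) ?q = map (next_in (set ?q)) ?q'" using *(2) seq by metis
    show "inj_on (next_in (set ?q)) (set ?q \<union> set ?q')" using seq by (simp add: inj_on_next_in)
  qed
  then show "p = p'" using *(1,3) split3[of p i m] split3[of p' i m] by metis
qed

lemma rotate_values_window:
  assumes "i \<le> k" "k + c \<le> i + m" "i + m \<le> length p"
  shows "take c (drop k (rotate_values i m p)) = map (next_in (set (take m (drop i p)))) (take c (drop k p))"
proof (rule nth_equalityI)
  show "length (take c (drop k (rotate_values i m p)))
      = length (map (next_in (set (take m (drop i p)))) (take c (drop k p)))"
    using assms by (simp add: rotate_values_def Let_def)
  fix l assume "l < length (take c (drop k (rotate_values i m p)))"
  then show "take c (drop k (rotate_values i m p)) ! l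
      = map (next_in (set (take m (drop i p)))) (take c (drop k p)) ! l"
    using assms by (auto simp: rotate_values_def Let_def nth_append)
qed

lemma hit_rotate_values_imp:
  assumes "p \<in> perms n" "i \<le> k" "k + c \<le> i + m" "i + m \<le> n" "hit c k p"
  shows "hit c k (rotate_values i m p)"
proof -
  have "take c (drop k p) = take c (drop (k - i) (take m (drop i p)))"
    using assms(2,3) by (simp add: drop_take min_def)
  then have "set (take c (drop k p)) \<subseteq> set (take m (drop i p))"
    by (metis set_drop_subset set_take_subset subset_trans)
  then show ?thesis
    using assms rotate_values_window[of i k c m p] perms_length[of p n]
    by (auto simp: hit_def perms_def intro!: cyc_sorted_map_next_in)
qed

text \<open>Only the preservation of hits is proved directly. For the converse, the rotation maps
  the finite set \<open>?T\<close> injectively into itself, hence onto itself, so nothing outside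
  \<open>?T\<close> can be sent into it.\<close>

lemma hit_rotate_values:
  assumes "p \<in> perms n" "i \<le> k" "k + c \<le> i + m" "i + m \<le> n"
  shows "hit c k (rotate_values i m p) \<longleftrightarrow> hit c k p"
proof
  let ?T = "{p \<in> perms n. hit c k p}"
  assume h: "hit c k (rotate_values i m p)"
  have inj: "inj_on (rotate_values i m) ?T"
    using inj_on_rotate_values by (rule inj_on_subset) auto
  have "rotate_values i m ` ?T = ?T"
    using assms finite_perms inj
    by (intro endo_inj_surj) (auto intro: rotate_values_perms hit_rotate_values_imp)
  moreover have "rotate_values i m p \<in> ?T" using h rotate_values_perms[OF assms(1)] by simp
  ultimately have "rotate_values i m p \<in> rotate_values i m ` ?T" by (simp only:)
  then obtain p' where p': "rotate_values i m p = rotate_values i m p'" "p' \<in> ?T" by (rule imageE)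
  then have "p = p'" using inj_onD[OF inj_on_rotate_values p'(1)] assms(1) by simp
  then show "hit c k p" using p' by simp
qed (rule hit_rotate_values_imp[OF assms])

lemma bij_rotate_values:
  assumes "i \<le> j" "j + c = i + m" "i + m \<le> n"
  shows "bij_betw (rotate_values i m) (consec_hits c n i j) (consec_hits c n i j)"
proof -
  have inj: "inj_on (rotate_values i m) (consec_hits c n i j)"
    using inj_on_rotate_values by (rule inj_on_subset) (auto simp: consec_hits_def)
  have "rotate_values i m ` consec_hits c n i j \<subseteq> consec_hits c n i j"
    using assms by (auto simp: consec_hits_def rotate_values_perms hit_rotate_values)
  then show ?thesis using inj endo_inj_surj[OF finite_consec_hits] by (auto simp: bij_betw_def)
qed

text \<open>On values this is a cycle of length \<open>m\<close>. The parity is counted inside the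
  block and carried to the whole word by \<open>invl_append_mset\<close>.\<close>

lemma psign_rotate_values:
  assumes "p \<in> perms n" "i + m \<le> n" "0 < m"
  shows "psign (rotate_values i m p) = (- 1) ^ (m - 1) * psign p"
proof -
  let ?q = "take m (drop i p)"
  let ?q' = "map (next_in (set ?q)) ?q"
  have q: "distinct ?q" "?q \<noteq> []" "length ?q = m"
    using assms perms_length[of p n] by (auto simp: perms_def)
  have "invl (rotate_values i m p) + invl ?q = invl p + invl ?q'"
    using invl_append_mset[OF mset_map_next_in[OF q(1)], of "take i p" "drop (i + m) p"] split3[of p i m]
    by (simp add: rotate_values_def Let_def)
  moreover have "even (invl ?q' + invl ?q + (m - 1))"
    using invl_map_next_in[OF q(1,2)] q(3) by simp
  ultimately have "even (invl (rotate_values i m p)) = even (m - 1 + invl p)"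
    using even_add by metis
  then show ?thesis by (simp add: psign_def uminus_power_if flip: power_add)
qed

text \<open>Here \<open>m\<close> is the length of the stretch covered by the windows from
  \<open>i\<close> to \<open>j\<close>. A cycle of even length reverses the sign, so the sum equals
  its own negative.\<close>

lemma consec_hits_sum_even:
  assumes "i \<le> j" "j + c = i + m" "i + m \<le> n" "even m" "0 < m"
  shows "(\<Sum>p\<in>consec_hits c n i j. psign p) = 0"
proof -
  have "psign (rotate_values i m p) = (- 1) * psign p" if "p \<in> consec_hits c n i j" for p
    using psign_rotate_values[of p n i m] that assms by (simp add: consec_hits_def)
  then have "(\<Sum>p\<in>consec_hits c n i j. psign p) = (- 1) * (\<Sum>p\<in>consec_hits c n i j. psign p)"
    by (rule sum_psign_scale[OF bij_rotate_values[OF assms(1-3)]])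
  then show ?thesis by simp
qed

text \<open>The windows cover the whole word, and rotating all \<open>n\<close> values preserves the
  sign because \<open>n\<close> is odd. The rotation carries the fibre of \<open>p ! j = v\<close>
  to that of \<open>v + 1\<close>, so all \<open>n\<close> fibres have the same signed sum.\<close>

lemma consec_hits_sum_full:
  assumes "odd n" "j + c = n" "j < n"
  shows "(\<Sum>p\<in>consec_hits c n 0 j. psign p)
       = int n * (\<Sum>p\<in>{p \<in> consec_hits c n 0 j. p ! j = 1}. psign p)"
proof -
  let ?D = "consec_hits c n 0 j" and ?f = "rotate_values 0 n"
  let ?S = "\<lambda>v. \<Sum>p\<in>{p \<in> ?D. p ! j = v}. psign p"
  have f_nth: "?f p ! j = next_in {1..n} (p ! j)" if "p \<in> ?D" for p
    using that assms perms_length[of p n]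
    by (auto simp: rotate_values_def consec_hits_def perms_def nth_append)
  have range: "p ! j \<in> {1..n}" if "p \<in> ?D" for p
  proof -
    have "p ! j \<in> set p" using that assms perms_length[of p n] by (auto simp: consec_hits_def)
    then show ?thesis using that by (auto simp: consec_hits_def perms_def)
  qed
  \<comment> \<open>Staying below \<open>n\<close> avoids the wrap-around of \<open>next_in\<close>;
    the steps from 1 to \<open>n\<close> already reach every fibre.\<close>
  have step: "?S (v + 1) = ?S v" if v: "1 \<le> v" "v < n" for v
  proof -
    have bij: "bij_betw ?f ?D ?D" using assms by (intro bij_rotate_values) auto
    have iff: "?f p ! j = v + 1 \<longleftrightarrow> p ! j = v" if "p \<in> ?D" for p
    proof -
      have "?f p ! j = v + 1 \<longleftrightarrow> next_in {1..n} (p ! j) = next_in {1..n} v"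
        using f_nth[OF that] next_in_interval[OF v] by simp
      also have "\<dots> \<longleftrightarrow> p ! j = v"
        using range[OF that] v by (intro inj_on_eq_iff[OF inj_on_next_in]) auto
      finally show ?thesis .
    qed
    have "bij_betw ?f {p \<in> ?D. p ! j = v} {p \<in> ?D. p ! j = v + 1}"
    proof (rule bij_betw_imageI)
      show "inj_on ?f {p \<in> ?D. p ! j = v}"
        using bij_betw_imp_inj_on[OF bij] by (rule inj_on_subset) simp
      show "?f ` {p \<in> ?D. p ! j = v} = {p \<in> ?D. p ! j = v + 1}"
      proof (intro equalityI subsetI)
        fix p assume "p \<in> ?f ` {p \<in> ?D. p ! j = v}"
        then show "p \<in> {p \<in> ?D. p ! j = v + 1}" using iff bij_betwE[OF bij] by auto
      next
        fix p assume p: "p \<in> {p \<in> ?D. p ! j = v + 1}"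
        then obtain p' where p': "p' \<in> ?D" "p = ?f p'" using bij_betw_imp_surj_on[OF bij] by blast
        then have "p' ! j = v" using p iff by simp
        then show "p \<in> ?f ` {p \<in> ?D. p ! j = v}" using p' by simp
      qed
    qed
    moreover have "psign (?f p) = 1 * psign p" if "p \<in> {p \<in> ?D. p ! j = v}" for p
      using that psign_rotate_values[of p n 0 n] assms by (auto simp: consec_hits_def)
    ultimately have "?S (v + 1) = 1 * ?S v" by (rule sum_psign_scale)
    then show ?thesis by (simp only: mult_1)
  qed
  have const: "?S (Suc v) = ?S 1" if "v < n" for v
    using that
  proof (induction v)
    case (Suc v)
    then show ?case using step[of "Suc v"] by simp
  qed simp
  have "(\<Sum>p\<in>?D. psign p) = (\<Sum>v\<in>{1..n}. ?S v)"
    using range by (intro sum.group[symmetric] finite_consec_hits) auto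
  also have "\<dots> = (\<Sum>v\<in>{1..n}. ?S 1)"
  proof (rule sum.cong[OF refl])
    fix v assume "v \<in> {1..n}"
    then have "v - 1 < n" "Suc (v - 1) = v" by auto
    then show "?S v = ?S 1" using const[of "v - 1"] by (simp only:)
  qed
  finally show ?thesis by simp
qed

subsection \<open>Signed ballot shuffles\<close>

text \<open>Reflection form of the ballot numbers: for \<open>t\<close> at most \<open>s\<close> it
  counts words with \<open>s\<close> and \<open>t\<close> letters of two kinds in which the second
  kind never leads. The case \<open>t = 0\<close> is separate because \<open>t - 1\<close> would be
  0 and 1 would be subtracted.\<close>

definition ballot :: "nat \<Rightarrow> nat \<Rightarrow> int" where
  "ballot s t = int ((s + t) choose t) - (if t = 0 then 0 else int ((s + t) choose (t - 1)))"

lemma ballot_0: "ballot s 0 = 1"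
  by (simp add: ballot_def)

lemma ballot_Suc: "ballot (Suc s) (Suc t) = ballot (Suc s) t + ballot s (Suc t)"
  by (cases t) (simp_all add: ballot_def)

lemma ballot_above_diagonal: "ballot s (Suc s) = 0"
  using binomial_symmetric[of s "s + Suc s"] by (simp add: ballot_def)

text \<open>Absorption shows that the central binomial coefficient is \<open>k + 1\<close> times the
  ballot difference, so the division in \<open>catalan\<close> is exact.\<close>

lemma catalan_eq_ballot: "int (catalan k) = ballot k k"
proof (cases k)
  case 0
  then show ?thesis by (simp add: catalan_def ballot_def)
next
  case (Suc m)
  have "Suc k * (2 * k choose Suc k) = k * (2 * k choose k)"
    using binomial_absorb_comp[of "2 * k" k] Suc_times_binomial_eq[of "2 * k - 1" k] Suc
    by (simp add: mult.commute del: binomial_Suc_Suc)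
  moreover have "2 * k choose Suc k = 2 * k choose m"
    using binomial_symmetric[of m "2 * k"] Suc by simp
  ultimately have "int k * int (2 * k choose k) = int (Suc k) * int (2 * k choose m)"
    by (metis of_nat_mult)
  then have "int (2 * k choose k) = (int k + 1) * (int (2 * k choose k) - int (2 * k choose m))"
    by (simp add: algebra_simps)
  moreover have "ballot k k = int (2 * k choose k) - int (2 * k choose m)"
    using Suc by (simp add: ballot_def mult_2 del: binomial_Suc_Suc)
  ultimately have "int (2 * k choose k) = (int k + 1) * ballot k k" by metis
  then have "int (2 * k choose k) div (int k + 1) = ballot k k" by simp
  then show ?thesis by (simp add: catalan_def zdiv_int add.commute)
qed

text \<open>Reading values upwards, \<open>A\<close> strictly leads whenever a letter of
  \<open>C\<close> has just been read. The bound \<open>i + 1 < x\<close> is demanded, not assumed,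
  so \<open>nth\<close> stays in range and a too short \<open>A\<close> admits no shuffle. The
  offset \<open>g\<close> leaves room for the values of the middle block.\<close>

definition ballot_shuffles :: "nat \<Rightarrow> nat \<Rightarrow> nat \<Rightarrow> (nat list \<times> nat list) set" where
  "ballot_shuffles g x y = {(A, C). length A = x \<and> length C = y \<and> sorted A \<and> sorted C \<and>
     distinct (A @ C) \<and> set (A @ C) = {g + 1..g + x + y} \<and> (\<forall>i<y. i + 1 < x \<and> A ! (i + 1) < C ! i)}"

lemma ballot_shuffles_0: "ballot_shuffles g x 0 = {([g + 1..<g + x + 1], [])}"
proof -
  have "A = [g + 1..<g + x + 1]" if "sorted A" "distinct A" "set A = {g + 1..g + x}" for A
    using that by (intro sorted_distinct_set_unique) (auto simp del: upt_Suc)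
  then show ?thesis
    by (auto simp: ballot_shuffles_def atLeastLessThanSuc_atLeastAtMost simp del: upt_Suc)
qed

lemma ballot_shuffles_empty: "x \<le> y \<Longrightarrow> 0 < y \<Longrightarrow> ballot_shuffles g x y = {}"
  by (auto simp: ballot_shuffles_def intro!: exI[of _ "y - 1"])

lemma finite_ballot_shuffles: "finite (ballot_shuffles g x y)"
proof (rule finite_subset)
  let ?L = "\<lambda>k. {A. set A \<subseteq> {g + 1..g + x + y} \<and> length A = k}"
  show "ballot_shuffles g x y \<subseteq> ?L x \<times> ?L y" by (auto simp: ballot_shuffles_def)
  show "finite (?L x \<times> ?L y)" by (intro finite_cartesian_product finite_lists_length_eq) auto
qed

lemma sorted_last_Max:
  assumes "sorted xs" "M \<in> set xs" "\<forall>x\<in>set xs. x \<le> M"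
  obtains ys where "xs = ys @ [M]"
proof (cases xs rule: rev_cases)
  case (snoc ys y)
  then have "y = M" using assms by (auto simp: sorted_append intro: antisym)
  then show ?thesis using that snoc by simp
qed (use assms in simp)

text \<open>The largest letter \<open>M\<close> ends \<open>C\<close> or ends \<open>A\<close>. When
  it is appended to \<open>C\<close>, the hypothesis \<open>y < x\<close> supplies its partner at
  index \<open>y + 1\<close> of \<open>A\<close>.\<close>

lemma ballot_shuffles_Suc:
  fixes g x y :: nat
  assumes "y < x"
  defines "M \<equiv> g + Suc x + Suc y"
  shows "ballot_shuffles g (Suc x) (Suc y) =
    (\<lambda>(A, C). (A, C @ [M])) ` ballot_shuffles g (Suc x) y \<union>
    (\<lambda>(A, C). (A @ [M], C)) ` ballot_shuffles g x (Suc y)" (is "?L = ?R1 \<union> ?R2")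
proof (intro equalityI subsetI)
  fix z assume "z \<in> ?L"
  then obtain A C where z: "z = (A, C)" and len: "length A = Suc x" "length C = Suc y"
    and s: "sorted A" "sorted C" and d: "distinct (A @ C)"
    and set: "set (A @ C) = {g + 1..M}"
    and b: "\<And>i. i < Suc y \<Longrightarrow> i + 1 < Suc x \<and> A ! (i + 1) < C ! i"
    by (auto simp: ballot_shuffles_def M_def)
  have M: "M \<in> set (A @ C)" unfolding set by (simp add: M_def)
  have le: "\<forall>v\<in>set A. v \<le> M" "\<forall>v\<in>set C. v \<le> M" using set by auto
  have rest: "{g + 1..M} - {M} = {g + 1..g + x + Suc y}" by (auto simp: M_def)
  show "z \<in> ?R1 \<union> ?R2"
  proof (cases "M \<in> set C")
    case True
    obtain C' where C: "C = C' @ [M]" using sorted_last_Max[OF s(2) True le(2)] .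
    have "set (A @ C') = {g + 1..M} - {M}" using set d C by auto
    moreover have "A ! (i + 1) < C' ! i" if "i < y" for i
      using b[of i] that len C by (simp add: nth_append)
    ultimately have "(A, C') \<in> ballot_shuffles g (Suc x) y"
      using len s d b C rest assms(1) by (auto simp: ballot_shuffles_def sorted_append)
    then show ?thesis using z C by force
  next
    case False
    then have MA: "M \<in> set A" using M by simp
    obtain A' where A: "A = A' @ [M]" using sorted_last_Max[OF s(1) MA le(1)] .
    have "set (A' @ C) = {g + 1..M} - {M}" using set d A by auto
    moreover have "i + 1 < x \<and> A' ! (i + 1) < C ! i" if "i < Suc y" for i
    proof -
      \<comment> \<open>If \<open>i + 1\<close> were \<open>x\<close>, the entry of \<open>A\<close>
        there would be \<open>M\<close>, which no letter of \<open>C\<close> exceeds.\<close>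
      have "C ! i \<le> M" using le that len by simp
      then have "i + 1 \<noteq> x" using b[OF that] len A by (auto simp: nth_append)
      then show ?thesis using b[OF that] len A by (auto simp: nth_append)
    qed
    ultimately have "(A', C) \<in> ballot_shuffles g x (Suc y)"
      using len s d A rest by (auto simp: ballot_shuffles_def sorted_append)
    then show ?thesis using z A by force
  qed
next
  fix z assume "z \<in> ?R1 \<union> ?R2"
  then show "z \<in> ?L"
  proof
    assume "z \<in> ?R1"
    then obtain A C where z: "z = (A, C @ [M])" and m: "(A, C) \<in> ballot_shuffles g (Suc x) y" by auto
    have set: "set A \<union> set C = {g + 1..g + Suc x + y}" using m by (auto simp: ballot_shuffles_def)
    have "\<forall>v\<in>set A \<union> set C. v < M" unfolding set by (auto simp: M_def)
    then have lt: "\<forall>v\<in>set A. v < M" "\<forall>v\<in>set C. v < M" by auto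
    have "set A \<union> set (C @ [M]) = {g + 1..g + Suc x + Suc y}" using set by (auto simp: M_def)
    moreover have "A ! (i + 1) < (C @ [M]) ! i" if "i < Suc y" for i
    proof (cases "i = y")
      case True
      then have "A ! (i + 1) \<in> set A" "(C @ [M]) ! i = M"
        using m assms(1) by (auto simp: ballot_shuffles_def)
      then show ?thesis using lt by simp
    next
      case False
      then show ?thesis using m that by (auto simp: ballot_shuffles_def nth_append)
    qed
    moreover have "sorted (C @ [M])" using m lt by (auto simp: ballot_shuffles_def sorted_append intro: less_imp_le)
    moreover have "distinct (A @ C @ [M])" using m lt by (auto simp: ballot_shuffles_def)
    ultimately show ?thesis using m z assms(1) by (auto simp: ballot_shuffles_def)
  next
    assume "z \<in> ?R2"
    then obtain A C where z: "z = (A @ [M], C)" and m: "(A, C) \<in> ballot_shuffles g x (Suc y)" by auto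
    have set: "set A \<union> set C = {g + 1..g + x + Suc y}" using m by (auto simp: ballot_shuffles_def)
    have "\<forall>v\<in>set A \<union> set C. v < M" unfolding set by (auto simp: M_def)
    then have lt: "\<forall>v\<in>set A. v < M" "\<forall>v\<in>set C. v < M" by auto
    have "set (A @ [M]) \<union> set C = {g + 1..g + Suc x + Suc y}" using set by (auto simp: M_def)
    moreover have "i + 1 < Suc x \<and> (A @ [M]) ! (i + 1) < C ! i" if "i < Suc y" for i
      using m that by (auto simp: ballot_shuffles_def nth_append)
    moreover have "sorted (A @ [M])" using m lt by (auto simp: ballot_shuffles_def sorted_append intro: less_imp_le)
    moreover have "distinct ((A @ [M]) @ C)" using m lt by (auto simp: ballot_shuffles_def)
    ultimately show ?thesis using m z by (auto simp: ballot_shuffles_def)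
  qed
qed

definition ballot_sum :: "nat \<Rightarrow> nat \<Rightarrow> nat \<Rightarrow> int" where
  "ballot_sum g x y = (\<Sum>(A, C)\<in>ballot_shuffles g x y. psign (A @ C))"

lemma ballot_sum_0: "ballot_sum g x 0 = 1"
  unfolding ballot_sum_def ballot_shuffles_0 by (simp add: psign_def invl_sorted del: upt_Suc)

lemma ballot_sum_empty: "x \<le> y \<Longrightarrow> 0 < y \<Longrightarrow> ballot_sum g x y = 0"
  by (simp add: ballot_sum_def ballot_shuffles_empty)

lemma invl_insert_Max:
  assumes "\<forall>v\<in>set (A @ C). v < M"
  shows "invl (A @ M # C) = invl (A @ C) + length C"
proof -
  have "filter (\<lambda>x. M < x) A = []" "filter (\<lambda>y. y < M) C = C"
    using assms by (auto simp: filter_empty_conv filter_id_conv dest: less_asym)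
  then show ?thesis by (simp add: invl_insert)
qed

text \<open>\<open>M\<close> at the end of \<open>C\<close> creates no inversion; at the end of
  \<open>A\<close> it precedes all \<open>Suc y\<close> letters of \<open>C\<close> and is inverted
  with each.\<close>

lemma ballot_sum_Suc:
  assumes "y < x"
  shows "ballot_sum g (Suc x) (Suc y) = ballot_sum g (Suc x) y + (- 1) ^ Suc y * ballot_sum g x (Suc y)"
proof -
  define M where "M = g + Suc x + Suc y"
  let ?f1 = "\<lambda>(A, C). (A, C @ [M])" and ?f2 = "\<lambda>(A, C). (A @ [M], C)"
  let ?S1 = "ballot_shuffles g (Suc x) y" and ?S2 = "ballot_shuffles g x (Suc y)"
  let ?s = "\<lambda>(A, C). psign (A @ C)"
  have lt1: "\<forall>v\<in>set (A @ C). v < M" if "(A, C) \<in> ?S1" for A C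
    using that by (auto simp: ballot_shuffles_def M_def)
  have lt2: "\<forall>v\<in>set (A @ C). v < M" if "(A, C) \<in> ?S2" for A C
    using that by (auto simp: ballot_shuffles_def M_def)
  have "ballot_sum g (Suc x) (Suc y) = sum ?s (?f1 ` ?S1) + sum ?s (?f2 ` ?S2)"
    unfolding ballot_sum_def ballot_shuffles_Suc[OF assms, of g, folded M_def]
  proof (rule sum.union_disjoint)
    have "M \<notin> set A" if "(A, C) \<in> ?S1" for A C using lt1[OF that] by auto
    then show "?f1 ` ?S1 \<inter> ?f2 ` ?S2 = {}" by fastforce
  qed (simp_all add: finite_ballot_shuffles)
  also have "sum ?s (?f1 ` ?S1) = sum (?s \<circ> ?f1) ?S1"
    by (rule sum.reindex) (auto simp: inj_on_def)
  also have "\<dots> = sum ?s ?S1"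
  proof (rule sum.cong[OF refl], clarify)
    fix A C assume "(A, C) \<in> ?S1"
    then show "(?s \<circ> ?f1) (A, C) = psign (A @ C)"
      using lt1[of A C] invl_insert_Max[of "A @ C" "[]" M] by (simp add: psign_def)
  qed
  also have "sum ?s (?f2 ` ?S2) = sum (?s \<circ> ?f2) ?S2"
    by (rule sum.reindex) (auto simp: inj_on_def)
  also have "\<dots> = (\<Sum>z\<in>?S2. (- 1) ^ Suc y * ?s z)"
  proof (rule sum.cong[OF refl], clarify)
    fix A C assume m: "(A, C) \<in> ?S2"
    then have "length C = Suc y" by (simp add: ballot_shuffles_def)
    then show "(?s \<circ> ?f2) (A, C) = (- 1) ^ Suc y * psign (A @ C)"
      using lt2[OF m] invl_insert_Max[of A C M] by (simp add: psign_def power_add)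
  qed
  finally show ?thesis by (simp add: ballot_sum_def sum_distrib_left)
qed

text \<open>This solves the recursion of \<open>ballot_sum\<close>; it is the q-analogue of the ballot numbers at
  \<open>q = -1\<close>. The first letter of a shuffle always comes from the first list, hence the index shift
  in \<open>ballot_sum_eq\<close>.\<close>

definition signed_ballot :: "nat \<Rightarrow> nat \<Rightarrow> int" where
  "signed_ballot x y =
    (if x < y then 0 else if y = 0 then 1 else if odd x then ballot (x div 2) (y div 2)
     else if odd y then 0 else ballot (x div 2 - 1) (y div 2))"

text \<open>Split by parities. The recursion of \<open>ballot\<close> enters only for
  \<open>x\<close> even and \<open>y\<close> odd; otherwise a term on the right vanishes or the two
  terms cancel.\<close>

lemma signed_ballot_Suc:
  assumes "y \<le> x"
  shows "signed_ballot (Suc x) (Suc y) = signed_ballot (Suc x) y + (- 1) ^ Suc y * signed_ballot x (Suc y)"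
proof -
  consider s t where "x = 2 * s" "y = 2 * t" | s t where "x = 2 * s" "y = 2 * t + 1"
    | s t where "x = 2 * s + 1" "y = 2 * t" | s t where "x = 2 * s + 1" "y = 2 * t + 1"
    by (metis oddE evenE)
  then show ?thesis
  proof cases
    case 1
    then show ?thesis using assms by (auto simp: signed_ballot_def ballot_0)
  next
    case 2
    then obtain s' where "s = Suc s'" using assms by (cases s) auto
    then show ?thesis using 2 assms by (auto simp: signed_ballot_def ballot_Suc)
  next
    case 3
    then show ?thesis using assms by (auto simp: signed_ballot_def ballot_0)
  next
    case 4
    \<comment> \<open>For \<open>s = t\<close> both terms on the right are 0, and the left side is
      \<open>ballot s (Suc s)\<close>.\<close>
    then show ?thesis using assms ballot_above_diagonal[of s]
      by (cases "s = t") (auto simp: signed_ballot_def)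
  qed
qed

lemma ballot_sum_eq: "ballot_sum g (Suc x) y = signed_ballot x y"
proof (induction "x + y" arbitrary: x y rule: less_induct)
  case less
  show ?case
  proof (cases "y = 0 \<or> x < y")
    case True
    then show ?thesis by (auto simp: ballot_sum_0 ballot_sum_empty signed_ballot_def)
  next
    case False
    then obtain x' y' where xy: "x = Suc x'" "y = Suc y'" "y' \<le> x'" by (cases x; cases y) auto
    then show ?thesis
      using less[of x y'] less[of x' y] by (simp add: ballot_sum_Suc signed_ballot_Suc)
  qed
qed

text \<open>The second list has \<open>d - 1\<close> letters because \<open>n\<close> will be forced
  to the end of the third block. Both arguments of \<open>signed_ballot\<close> become the odd
  number \<open>2 * k + 1\<close>, which halves to \<open>k\<close>.\<close>

lemma ballot_sum_catalan:
  assumes "even d" "2 \<le> d"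
  shows "ballot_sum g d (d - 1) = int (catalan ((d - 2) div 2))"
proof -
  define k where "k = d div 2 - 1"
  have d: "d = 2 * k + 2" using assms by (auto simp: k_def elim!: evenE)
  then have "ballot_sum g d (d - 1) = signed_ballot (2 * k + 1) (2 * k + 1)"
    using ballot_sum_eq[of g "2 * k + 1" "2 * k + 1"] by simp
  also have "\<dots> = ballot k k" by (simp add: signed_ballot_def)
  finally show ?thesis using d by (simp add: catalan_eq_ballot)
qed

subsection \<open>The signed sum over non-avoiders\<close>

text \<open>The window at \<open>i\<close> reads \<open>drop i A\<close>, then \<open>B\<close>,
  then \<open>take i C\<close>. Rotated to start with the 1 that heads \<open>B\<close>, it is
  cyclically sorted only if sorted.\<close>

lemma hit_iff_sorted:
  assumes "length A = d" "length B = g" "length C = d" "i \<le> d"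
    and "B = 1 # B'" "\<forall>v\<in>set (B' @ A @ C). 1 < v"
  shows "hit (g + d) i (A @ B @ C) \<longleftrightarrow> sorted (B @ take i C @ drop i A)"
proof -
  have "take (g + d) (drop i (A @ B @ C)) = drop i A @ (B @ take i C)" using assms(1-4) by simp
  then have "hit (g + d) i (A @ B @ C) \<longleftrightarrow> cyc_sorted ((B @ take i C) @ drop i A)"
    by (simp only: hit_def cyc_sorted_append_commute[of "drop i A"])
  also have "\<dots> \<longleftrightarrow> cyc_sorted (1 # (B' @ take i C @ drop i A))" using assms(5) by simp
  also have "\<dots> \<longleftrightarrow> sorted (1 # (B' @ take i C @ drop i A))"
    using assms(6) by (intro cyc_sorted_Min_Cons) (auto dest: in_set_takeD in_set_dropD)
  finally show ?thesis using assms(5) by simp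
qed

text \<open>Only the seam can fail, where the last letter of \<open>take i C\<close> meets the first
  letter of \<open>drop i A\<close>. So the absence of a hit at \<open>i\<close> becomes one ballot
  inequality.\<close>

lemma sorted_exchange_iff:
  assumes "sorted (B @ A)" "sorted (B @ C)" "0 < i" "i < length A" "i \<le> length C"
  shows "sorted (B @ take i C @ drop i A) \<longleftrightarrow> C ! (i - 1) \<le> A ! i"
proof
  assume "sorted (B @ take i C @ drop i A)"
  then have "\<forall>x\<in>set (take i C). \<forall>y\<in>set (drop i A). x \<le> y" by (auto simp: sorted_append)
  moreover have "C ! (i - 1) \<in> set (take i C)"
    using assms by (auto simp: in_set_conv_nth intro!: exI[of _ "i - 1"])
  moreover have "A ! i \<in> set (drop i A)"
    using assms by (metis Cons_nth_drop_Suc list.set_intros(1))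
  ultimately show "C ! (i - 1) \<le> A ! i" by blast
next
  assume le: "C ! (i - 1) \<le> A ! i"
  have "x \<le> y" if xy: "x \<in> set (take i C)" "y \<in> set (drop i A)" for x y
  proof -
    obtain k where k: "x = C ! k" "k < i" "k < length C" using xy(1) by (auto simp: in_set_conv_nth)
    obtain l where l: "y = A ! (i + l)" "i + l < length A" using xy(2) by (auto simp: in_set_conv_nth)
    have "C ! k \<le> C ! (i - 1)" using assms k by (auto simp: sorted_append intro!: sorted_nth_mono)
    moreover have "A ! i \<le> A ! (i + l)" using assms l by (auto simp: sorted_append intro!: sorted_nth_mono)
    ultimately show ?thesis using le k l by simp
  qed
  then show "sorted (B @ take i C @ drop i A)"
    using assms(1,2) by (auto simp: sorted_append sorted_wrt_take sorted_wrt_drop dest: in_set_takeD in_set_dropD)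
qed

text \<open>The hits at 0 and \<open>d\<close> make \<open>B @ A\<close> and \<open>B @ C\<close>
  sorted, and each position in between without a hit gives one inequality. The one at
  \<open>d - 1\<close> forces \<open>n\<close> to end \<open>C\<close>, so \<open>n\<close> is split
  off.\<close>

lemma consec_hits_normalized:
  fixes g d :: nat
  assumes "0 < g" "2 \<le> d"
  defines "n \<equiv> g + 2 * d"
  shows "{p \<in> consec_hits (g + d) n 0 d. p ! d = 1} =
    (\<lambda>(A, C). A @ [1..<g + 1] @ C @ [n]) ` ballot_shuffles g d (d - 1)" (is "?D = ?F ` ?S")
proof (intro equalityI subsetI)
  fix p assume "p \<in> ?D"
  then have p: "p \<in> perms n" "p ! d = 1" and h0: "hit (g + d) 0 p" and hd: "hit (g + d) d p"
    and no: "\<And>k. 0 < k \<Longrightarrow> k < d \<Longrightarrow> \<not> hit (g + d) k p"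
    by (auto simp: consec_hits_def)
  define A B C where "A = take d p" and "B = take g (drop d p)" and "C = drop (d + g) p"
  have len_p: "length p = n" using p perms_length by auto
  have pABC: "p = A @ B @ C" unfolding A_def B_def C_def by (rule split3)
  have len: "length A = d" "length B = g" "length C = d" using len_p by (auto simp: A_def B_def C_def n_def)
  have set_p: "set A \<union> set B \<union> set C = {1..n}" and dist: "distinct (A @ B @ C)"
    using p pABC by (auto simp: perms_def)
  have "B ! 0 = 1" using p(2) pABC len assms(1) by (simp add: nth_append)
  then obtain B' where B: "B = 1 # B'" using len assms(1) by (cases B) auto
  have gt1: "\<forall>v\<in>set (B' @ A @ C). 1 < v"
  proof
    fix v assume v: "v \<in> set (B' @ A @ C)"
    then have "v \<in> {1..n}" using set_p B by auto
    moreover have "v \<noteq> 1" using v dist B by auto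
    ultimately show "1 < v" by auto
  qed
  note hit_iff = hit_iff_sorted[OF len _ B gt1, folded pABC]
  have sA: "sorted (B @ A)" using hit_iff[of 0] h0 by simp
  have sC: "sorted (B @ C)" using hit_iff[of d] hd len by simp
  have b: "A ! i < C ! (i - 1)" if "0 < i" "i < d" for i
    using hit_iff[of i] no[of i] that sorted_exchange_iff[OF sA sC] len by auto
  \<comment> \<open>No letter of \<open>B\<close> exceeds a letter of \<open>A\<close> or
    \<open>C\<close>, so sorting the rest after \<open>B\<close> gives the identity, and
    \<open>B\<close> is its prefix.\<close>
  have "B @ sort (A @ C) = [1..<n + 1]"
  proof (rule sorted_distinct_set_unique)
    have "set (B @ sort (A @ C)) = {1..n}" using set_p by auto
    then show "set (B @ sort (A @ C)) = set [1..<n + 1]"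
      by (simp only: set_upt atLeastLessThanSuc_atLeastAtMost Suc_eq_plus1[symmetric])
  qed (use sA sC dist in \<open>auto simp: sorted_append simp del: upt_Suc\<close>)
  then have "B = take g [1..<n + 1]" using len by (metis append_eq_conv_conj)
  then have B_eq: "B = [1..<g + 1]" by (simp add: n_def take_upt del: upt_Suc)
  have "set (A @ C) = {1..n} - set B" using set_p dist by auto
  then have set_AC: "set (A @ C) = {g + 1..n}" unfolding B_eq by (auto simp del: upt_Suc)
  have le: "\<forall>v\<in>set A. v \<le> n" "\<forall>v\<in>set C. v \<le> n" using set_AC by auto
  have "n \<in> set (A @ C)" unfolding set_AC using assms by simp
  \<comment> \<open>Otherwise \<open>n\<close> would be the last letter of \<open>A\<close>, yet the
    inequality at \<open>d - 1\<close> puts a letter of \<open>C\<close> above it.\<close>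
  have "n \<notin> set A"
  proof
    assume "n \<in> set A"
    then obtain A' where "A = A' @ [n]" using sorted_last_Max[of A n] sA le by (auto simp: sorted_append)
    then have "A ! (d - 1) = n" using len(1) by auto
    moreover have "A ! (d - 1) < C ! (d - 2)" using b[of "d - 1"] assms(2) by (simp add: numeral_2_eq_2)
    moreover have "C ! (d - 2) \<le> n" using le len assms(2) by simp
    ultimately show False by simp
  qed
  then have "n \<in> set C" using \<open>n \<in> set (A @ C)\<close> by simp
  then obtain C' where C: "C = C' @ [n]" using sorted_last_Max[of C n] sC le by (auto simp: sorted_append)
  have "set (A @ C') = {g + 1..n} - {n}" using set_AC dist C \<open>n \<notin> set A\<close> by auto
  also have "\<dots> = {g + 1..g + d + (d - 1)}" using assms(2) by (auto simp: n_def)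
  finally have "set (A @ C') = {g + 1..g + d + (d - 1)}" .
  moreover have "A ! (i + 1) < C' ! i" if "i < d - 1" for i
    using b[of "i + 1"] that len C by (simp add: nth_append)
  ultimately have "(A, C') \<in> ?S"
    using len sA sC dist C by (auto simp: ballot_shuffles_def sorted_append)
  moreover have "p = ?F (A, C')" using pABC B_eq C by simp
  ultimately show "p \<in> ?F ` ?S" by blast
next
  fix p assume "p \<in> ?F ` ?S"
  then obtain A C' where m: "(A, C') \<in> ?S" and p: "p = A @ [1..<g + 1] @ C' @ [n]" by auto
  define B C where "B = [1..<g + 1]" and "C = C' @ [n]"
  have pABC: "p = A @ B @ C" using p by (simp add: B_def C_def)
  have len: "length A = d" "length B = g" "length C = d"
    using m assms(2) by (auto simp: ballot_shuffles_def B_def C_def simp del: upt_Suc)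
  have set: "set A \<union> set C' = {g + 1..g + d + (d - 1)}" using m by (auto simp: ballot_shuffles_def)
  have "\<forall>v\<in>set A \<union> set C'. v < n" unfolding set using assms by (auto simp: n_def)
  then have lt: "\<forall>v\<in>set A. v < n" "\<forall>v\<in>set C'. v < n" by auto
  have set_AC: "set (A @ C) = {g + 1..n}" using set assms(2) by (auto simp: C_def n_def)
  have setB: "set B = {1..g}" by (auto simp: B_def simp del: upt_Suc)
  have "B = 1 # [2..<g + 1]" using assms(1) upt_conv_Cons[of 1 "g + 1"] by (simp add: B_def numeral_2_eq_2)
  then obtain B' where B: "B = 1 # B'" ..
  have dB: "distinct B" "sorted B" by (simp_all add: B_def del: upt_Suc)
  have gt: "\<forall>v\<in>set (A @ C). \<forall>w\<in>set B. w < v" unfolding set_AC setB by auto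
  have gt1: "\<forall>v\<in>set (B' @ A @ C). 1 < v"
  proof
    fix v assume "v \<in> set (B' @ A @ C)"
    then have "v \<in> set B \<union> set (A @ C)" "v \<noteq> 1" using B dB gt by auto
    then show "1 < v" unfolding set_AC setB by auto
  qed
  note hit_iff = hit_iff_sorted[OF len _ B gt1, folded pABC]
  have "sorted A" "sorted C" using m lt by (auto simp: ballot_shuffles_def C_def sorted_append intro: less_imp_le)
  then have sA: "sorted (B @ A)" and sC: "sorted (B @ C)"
    using dB gt by (auto simp: sorted_append intro: less_imp_le)
  have dist: "distinct (A @ C)" using m lt by (auto simp: ballot_shuffles_def C_def)
  have "set B \<union> set (A @ C) = {1..n}" unfolding set_AC setB by (auto simp: n_def)
  then have "p \<in> perms n" using dist dB gt unfolding pABC perms_def by fastforce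
  moreover have "hit (g + d) 0 p" using hit_iff[of 0] sA by simp
  moreover have "hit (g + d) d p" using hit_iff[of d] sC len by simp
  moreover have "\<not> hit (g + d) k p" if k: "0 < k" "k < d" for k
  proof -
    have "A ! k < C' ! (k - 1)" "k - 1 < length C'"
      using m k by (auto simp: ballot_shuffles_def dest!: spec[of _ "k - 1"])
    then have "A ! k < C ! (k - 1)" by (simp add: C_def nth_append)
    then show ?thesis using hit_iff[of k] k sorted_exchange_iff[OF sA sC] len by simp
  qed
  moreover have "p ! d = 1" using len B by (simp add: pABC nth_append)
  ultimately show "p \<in> ?D" by (auto simp: consec_hits_def)
qed

text \<open>Compared with \<open>A @ C\<close>, the middle block adds \<open>d * g\<close>
  inversions, an even number as \<open>d\<close> is even, and the final \<open>n\<close> adds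
  none.\<close>

lemma consec_hits_sum_normalized:
  fixes g d :: nat
  assumes "0 < g" "2 \<le> d" "even d"
  shows "(\<Sum>p\<in>{p \<in> consec_hits (g + d) (g + 2 * d) 0 d. p ! d = 1}. psign p) = int (catalan ((d - 2) div 2))"
proof -
  define n where "n = g + 2 * d"
  let ?F = "\<lambda>(A, C). A @ [1..<g + 1] @ C @ [n]" and ?S = "ballot_shuffles g d (d - 1)"
  have "inj_on ?F ?S" by (auto simp: inj_on_def ballot_shuffles_def simp del: upt_Suc)
  then have "(\<Sum>p\<in>?F ` ?S. psign p) = sum (psign \<circ> ?F) ?S" by (rule sum.reindex)
  also have "\<dots> = (\<Sum>(A, C)\<in>?S. psign (A @ C))"
  proof (rule sum.cong[OF refl], clarify)
    fix A C assume m: "(A, C) \<in> ?S"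
    have set: "set (A @ C) = {g + 1..g + d + (d - 1)}" using m by (auto simp: ballot_shuffles_def)
    have lt: "\<forall>v\<in>set (A @ C). v < n" unfolding set using assms(2) by (auto simp: n_def)
    have gt: "\<forall>b\<in>set [1..<g + 1]. \<forall>x\<in>set (A @ (C @ [n])). b < x"
      using set assms(2) by (auto simp: n_def simp del: upt_Suc)
    have "invl (A @ [1..<g + 1] @ C @ [n]) = invl (A @ C @ [n]) + length A * g"
      using invl_insert_below[OF _ gt] by (simp del: upt_Suc)
    also have "invl (A @ C @ [n]) = invl (A @ C)" using invl_insert_Max[of "A @ C" "[]" n] lt by simp
    also have "length A = d" using m by (simp add: ballot_shuffles_def)
    finally show "(psign \<circ> ?F) (A, C) = psign (A @ C)"
      using assms(3) by (simp add: psign_def power_add power_mult del: upt_Suc)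
  qed
  also have "\<dots> = int (catalan ((d - 2) div 2))"
    using ballot_sum_catalan[OF assms(3,2)] by (simp add: ballot_sum_def)
  finally show ?thesis unfolding consec_hits_normalized[OF assms(1,2)] n_def .
qed

text \<open>The windows leave \<open>d - (j - i)\<close> letters outside. If this is 1, they cover
  an even number of letters and rotation cancels; otherwise two outside letters can be
  exchanged.\<close>

lemma consec_hits_sum_zero:
  assumes "odd c" "even d" "2 \<le> d" "i \<le> j" "j \<le> d" "i \<noteq> 0 \<or> j \<noteq> d"
  shows "(\<Sum>p\<in>consec_hits c (c + d) i j. psign p) = 0"
proof (cases "j - i = d - 1")
  case True
  then show ?thesis using assms by (intro consec_hits_sum_even[where m = "c + (d - 1)"]) auto
next
  case False
  \<comment> \<open>Two free positions on the left, one on each side, or two on the right; the last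
    case is the one already excluded.\<close>
  consider "2 \<le> i" | "i = 1" "j < d" | "i = 0" "j + 2 \<le> d" | "i = 1" "j = d"
    using assms False by linarith
  then show ?thesis
  proof cases
    case 1
    then show ?thesis using assms by (intro consec_hits_sum_swap[where s = 0 and t = 1]) auto
  next
    case 2
    then show ?thesis using assms by (intro consec_hits_sum_swap[where s = 0 and t = "c + d - 1"]) auto
  next
    case 3
    then show ?thesis using assms by (intro consec_hits_sum_swap[where s = "c + d - 2" and t = "c + d - 1"]) auto
  next
    case 4
    then show ?thesis using False by simp
  qed
qed

theorem theorem2p22:
  fixes c n :: nat
  assumes "odd c" and "odd n" and "0 < c" and "c < n" and "n < 2 * c"
  shows "card {p \<in> perms n. has_hit c p \<and> odd_perm p}
       = card {p \<in> perms n. has_hit c p \<and> \<not> odd_perm p} + n * catalan ((n - c - 2) div 2)"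
proof -
  \<comment> \<open>\<open>d\<close> is the last window position, and \<open>g\<close> is the length
    of the overlap of the first and last windows, positive because \<open>n < 2 * c\<close>.\<close>
  define d g where "d = n - c" and "g = c - d"
  have "even d" using assms by (simp add: d_def)
  moreover have "0 < d" using assms by (simp add: d_def)
  ultimately have d: "even d" "2 \<le> d" by (auto elim!: evenE)
  have g: "0 < g" "c = g + d" "n = g + 2 * d" "n = c + d" using assms by (auto simp: g_def d_def)
  let ?T = "\<lambda>i j. \<Sum>p\<in>consec_hits c n i j. psign p"
  have zero: "?T i j = 0" if "i \<le> j" "j \<le> d" "i \<noteq> 0 \<or> j \<noteq> d" for i j
    using consec_hits_sum_zero[OF assms(1) d that] g(4) by simp
  have full: "?T 0 d = int (n * catalan ((d - 2) div 2))"
  proof -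
    have "?T 0 d = int n * (\<Sum>p\<in>{p \<in> consec_hits c n 0 d. p ! d = 1}. psign p)"
      using assms g by (intro consec_hits_sum_full) auto
    then show ?thesis using consec_hits_sum_normalized[OF g(1) d(2,1)] g(2,3) by simp
  qed
  have "(\<Sum>p\<in>{p \<in> perms n. \<exists>i\<le>d. hit c i p}. psign p) = (\<Sum>j\<le>d. ?T j j - (\<Sum>i<j. ?T i j))"
    by (rule psign_sum_non_avoiders)
  \<comment> \<open>Only the pair of positions 0 and \<open>d\<close> survives. Pairs enter with a
    minus sign, hence the excess of odd permutations.\<close>
  also have "\<dots> = (\<Sum>j\<le>d. if j = d then - ?T 0 d else 0)"
  proof (rule sum.cong[OF refl])
    fix j assume "j \<in> {..d}"
    then have j: "j \<le> d" by simp
    have "(\<Sum>i<j. ?T i j) = (\<Sum>i<j. if i = 0 then ?T 0 j else 0)"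
      using zero j by (intro sum.cong) auto
    \<comment> \<open>For \<open>j = 0\<close> the sum is empty, and the right side is 0 too since
      \<open>d\<close> is at least 2.\<close>
    also have "\<dots> = (if j = d then ?T 0 d else 0)"
      using zero[of 0 j] j d(2) by (cases "j = 0") (auto simp: sum.delta)
    finally have "(\<Sum>i<j. ?T i j) = (if j = d then ?T 0 d else 0)" .
    moreover have "?T j j = 0" using j d(2) by (intro zero) auto
    ultimately show "?T j j - (\<Sum>i<j. ?T i j) = (if j = d then - ?T 0 d else 0)" by simp
  qed
  also have "\<dots> = - ?T 0 d" by simp
  finally have sum: "(\<Sum>p\<in>{p \<in> perms n. \<exists>i\<le>d. hit c i p}. psign p) = - int (n * catalan ((d - 2) div 2))"
    using full by simp
  let ?S = "{p \<in> perms n. has_hit c p}"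
  have "?S = {p \<in> perms n. \<exists>i\<le>d. hit c i p}"
    using has_hit_iff assms by (auto simp: d_def)
  then have "int (card {p \<in> ?S. \<not> odd_perm p}) - int (card {p \<in> ?S. odd_perm p})
      = - int (n * catalan ((d - 2) div 2))"
    using psign_sum_diff[of ?S] finite_perms sum by simp
  then have "card {p \<in> ?S. odd_perm p} = card {p \<in> ?S. \<not> odd_perm p} + n * catalan ((d - 2) div 2)"
    by linarith
  then show ?thesis by (simp add: d_def conj_assoc)
qed

end
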